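(* Let $C$ be a field of characteristic $p>0$ and $(F,\theta)$ an ID-field containing $C(t)$ such that $\theta|_{C(t)}$ is the iterative derivation with respect to $t$. Let $L$ be a finitely generated separable field extension of $F$ with a higher derivation, also denoted $\theta$, extending $\theta$ on $F$. Let $x_1,\dots,x_k$ be a separating transcendence basis of $L/F$ and write $\theta(x_i)=x_i+\sum_{n\ge1}\xi_{i,n}T^n$. Assume $\xi_{i,n}\in L^p\cdot F$ for all $i$ and all $n\ge1$. Then for every $\ell_0\ge0$ the following are equivalent: (1) For all $j,m>0$ with $j+m\le p^{\ell_0+1}$: $\theta^{(j)}\circ\theta^{(m)}=\binom{j+m}{j}\theta^{(j+m)}$. (2) For all $0\le\ell\le\ell_0$: (a) for all $0\le m<p^\ell$ and $0<a<p$, $\theta^{(m+ap^\ell)}=\frac{1}{a!}(\theta^{(p^\ell)})^a\circ\theta^{(m)}$; (b) $(\theta^{(p^\ell)})^p=0$; (c) for all $0\le j<\ell$, $\theta^{(p^j)}\circ\theta^{(p^\ell)}=\theta^{(p^\ell)}\circ\theta^{(p^j)}$. (3) Condition (1) holds when both sides are evaluated at each $x_i$, $i=1,\dots,k$. (3') Condition (2) holds when evaluated at each $x_i$, $i=1,\dots,k$. (4) For all $0\le\ell\le\ell_0$ and $i=1,\dots,k$: $$\xi_{i,p^\ell}+\sum_{m=1}^{p^\ell-1}\theta^{(p^\ell)}(\xi_{i,m})(-t)^m\in\bigcap_{0\le j<\ell}\ker(\theta^{(p^j)})\cap\ker(\theta^{(p^\ell(p-1))}),$$ for all $1<a<p$: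 $\xi_{i,ap^\ell}=\frac{1}{a!}(\theta^{(p^\ell)})^{a-1}(\xi_{i,p^\ell})$, and for all $0<m<p^\ell$ and $0<a<p$: $\xi_{i,m+ap^\ell}=\frac{1}{a!}(\theta^{(p^\ell)})^a(\xi_{i,m})$.
   Context: A higher derivation on a ring $R$ is a ring homomorphism $\theta:R\to R[[T]]$ with $\theta(r)|_{T=0}=r$; write $\theta(r)=\sum_i\theta^{(i)}(r)T^i$. It is an iterative derivation (ID) if $\theta^{(i)}\circ\theta^{(j)}=\binom{i+j}{i}\theta^{(i+j)}$ for all $i,j\ge0$; an ID-field is a field with an ID. The iterative derivation with respect to $t$ on $C(t)$ is the $C$-algebra homomorphism with $\theta(t)=t+T$. $L^p\cdot F$ denotes the compositum of the subfield of $p$-th powers $L^p$ with $F$. *)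

theory Defs
  imports "HOL-Computational_Algebra.Computational_Algebra"
begin

text \<open>Subfields of an ambient field (the ambient type plays the role of L).\<close>
definition is_subfield :: "'a::field set \<Rightarrow> bool" where
  "is_subfield E \<longleftrightarrow> 0 \<in> E \<and> 1 \<in> E \<and> (\<forall>x\<in>E. \<forall>y\<in>E. x + y \<in> E \<and> x * y \<in> E)
     \<and> (\<forall>x\<in>E. - x \<in> E) \<and> (\<forall>x\<in>E. inverse x \<in> E)"

definition gen_field :: "'a::field set \<Rightarrow> 'a set \<Rightarrow> 'a set" where
  "gen_field K S = \<Inter>{E. is_subfield E \<and> K \<union> S \<subseteq> E}"

definition hder :: "('a \<Rightarrow> 'a fps) \<Rightarrow> nat \<Rightarrow> 'a \<Rightarrow> 'a" where
  "hder \<theta> n x = fps_nth (\<theta> x) n"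

definition higher_derivation :: "'a::field set \<Rightarrow> ('a \<Rightarrow> 'a fps) \<Rightarrow> bool" where
  "higher_derivation R \<theta> \<longleftrightarrow>
     (\<forall>x\<in>R. fps_nth (\<theta> x) 0 = x \<and> (\<forall>n. fps_nth (\<theta> x) n \<in> R)) \<and>
     (\<forall>x\<in>R. \<forall>y\<in>R. \<theta> (x + y) = \<theta> x + \<theta> y \<and> \<theta> (x * y) = \<theta> x * \<theta> y) \<and>
     \<theta> 1 = 1"

definition iterative_on :: "'a::field set \<Rightarrow> ('a \<Rightarrow> 'a fps) \<Rightarrow> bool" where
  "iterative_on R \<theta> \<longleftrightarrow>
     (\<forall>x\<in>R. \<forall>i j. hder \<theta> i (hder \<theta> j x) = of_nat ((i + j) choose i) * hder \<theta> (i + j) x)"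

definition alg_indep :: "'a::field set \<Rightarrow> (nat \<Rightarrow> 'a) \<Rightarrow> nat \<Rightarrow> bool" where
  "alg_indep K x k \<longleftrightarrow>
     (\<forall>(A :: (nat \<Rightarrow> nat) set) c. finite A \<and> (\<forall>\<alpha>\<in>A. \<forall>i\<ge>k. \<alpha> i = 0) \<and> (\<forall>\<alpha>\<in>A. c \<alpha> \<in> K) \<and>
        (\<Sum>\<alpha>\<in>A. c \<alpha> * (\<Prod>i<k. x i ^ \<alpha> i)) = 0 \<longrightarrow> (\<forall>\<alpha>\<in>A. c \<alpha> = 0))"

definition separable_over :: "'a::field set \<Rightarrow> 'a \<Rightarrow> bool" where
  "separable_over K y \<longleftrightarrow>
     (\<exists>q. q \<noteq> 0 \<and> (\<forall>i. coeff q i \<in> K) \<and> poly q y = 0 \<and> coprime q (pderiv q))"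

definition sep_trans_basis :: "'a::field set \<Rightarrow> (nat \<Rightarrow> 'a) \<Rightarrow> nat \<Rightarrow> bool" where
  "sep_trans_basis K x k \<longleftrightarrow>
     alg_indep K x k \<and> (\<forall>y. separable_over (gen_field K (x ` {..<k})) y)"

definition transcendental_over :: "'a::field set \<Rightarrow> 'a \<Rightarrow> bool" where
  "transcendental_over K t \<longleftrightarrow> (\<forall>q. (\<forall>i. coeff q i \<in> K) \<and> poly q t = 0 \<longrightarrow> q = 0)"

text \<open>Condition (1), evaluated at all points of X (X = UNIV gives (1), X = {x_i} gives (3)).\<close>
definition cond1 :: "('a::field \<Rightarrow> 'a fps) \<Rightarrow> nat \<Rightarrow> nat \<Rightarrow> 'a set \<Rightarrow> bool" where
  "cond1 \<theta> p l0 X \<longleftrightarrow>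
     (\<forall>j m. 0 < j \<and> 0 < m \<and> j + m \<le> p ^ (l0 + 1) \<longrightarrow>
        (\<forall>y\<in>X. hder \<theta> j (hder \<theta> m y) = of_nat ((j + m) choose j) * hder \<theta> (j + m) y))"

text \<open>Condition (2), evaluated at all points of X (X = UNIV gives (2), X = {x_i} gives (3')).\<close>
definition cond2 :: "('a::field \<Rightarrow> 'a fps) \<Rightarrow> nat \<Rightarrow> nat \<Rightarrow> 'a set \<Rightarrow> bool" where
  "cond2 \<theta> p l0 X \<longleftrightarrow>
     (\<forall>l\<le>l0.
        (\<forall>m a. m < p ^ l \<and> 0 < a \<and> a < p \<longrightarrow>
           (\<forall>y\<in>X. hder \<theta> (m + a * p ^ l) y
                     = inverse (of_nat (fact a)) * (hder \<theta> (p ^ l) ^^ a) (hder \<theta> m y))) \<and>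
        (\<forall>y\<in>X. (hder \<theta> (p ^ l) ^^ p) y = 0) \<and>
        (\<forall>j<l. \<forall>y\<in>X. hder \<theta> (p ^ j) (hder \<theta> (p ^ l) y) = hder \<theta> (p ^ l) (hder \<theta> (p ^ j) y)))"

definition cond4 :: "('a::field \<Rightarrow> 'a fps) \<Rightarrow> nat \<Rightarrow> nat \<Rightarrow> 'a \<Rightarrow> (nat \<Rightarrow> 'a) \<Rightarrow> nat \<Rightarrow> bool" where
  "cond4 \<theta> p l0 t x k \<longleftrightarrow>
     (\<forall>l\<le>l0. \<forall>i<k.
        (let \<xi> = (\<lambda>n. hder \<theta> n (x i));
             \<eta> = \<xi> (p ^ l) + (\<Sum>m=1..p ^ l - 1. hder \<theta> (p ^ l) (\<xi> m) * (- t) ^ m)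
         in (\<forall>j<l. hder \<theta> (p ^ j) \<eta> = 0) \<and> hder \<theta> (p ^ l * (p - 1)) \<eta> = 0 \<and>
            (\<forall>a. 1 < a \<and> a < p \<longrightarrow>
               \<xi> (a * p ^ l) = inverse (of_nat (fact a)) * (hder \<theta> (p ^ l) ^^ (a - 1)) (\<xi> (p ^ l))) \<and>
            (\<forall>m a. 0 < m \<and> m < p ^ l \<and> 0 < a \<and> a < p \<longrightarrow>
               \<xi> (m + a * p ^ l) = inverse (of_nat (fact a)) * (hder \<theta> (p ^ l) ^^ a) (\<xi> m))))"

end

theory Submission
  imports Defs
begin

text \<open>Let \<open>M = L\<^sup>p \<cdot> F\<close> and let the defect of order \<open>(j, m)\<close> be the difference of the two sides of
  condition (1). Modulo defects of smaller total degree it is a derivation, so it vanishes on a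
  field once it does on generators, and it extends uniquely along separable extensions. Hence
  iterativity up to a given order passes from the \<open>x\<^sub>i\<close> to \<open>L\<close>; and because
  \<open>\<theta>(z\<^sup>p) = \<theta>(z)\<^sup>p\<close>, iterativity up to order \<open>q\<close> on \<open>L\<close> gives it up to order \<open>p q\<close> on \<open>M\<close>.
  On any set stable under all \<open>\<theta>\<^sup>(\<^sup>n\<^sup>)\<close>, such as \<open>M \<union> {x\<^sub>i}\<close>, Lucas' theorem makes conditions (1)
  and (2) equivalent, which yields (3') by induction on the level. For (4), evaluate at the
  truncated Taylor series \<open>\<Sum>\<^bsub>m<q\<^esub> \<theta>\<^sup>(\<^sup>m\<^sup>)(x\<^sub>i)(-t)\<^sup>m\<close>: it differs from \<open>x\<^sub>i\<close> by an element of \<open>M\<close>,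
  is killed by the operators of order between \<open>0\<close> and \<open>q\<close>, and is sent by \<open>\<theta>\<^sup>(\<^sup>q\<^sup>)\<close> to the element
  occurring in (4).\<close>

section \<open>Binomial coefficients and power series in characteristic p\<close>

text \<open>General \<open>u\<close> and \<open>c\<close> serve two uses: \<open>1\<close>,
  \<open>1\<close> for Lucas' theorem, and \<open>- t\<close>, \<open>- 1\<close> for the operators
  on powers of \<open>- t\<close>.\<close>

lemma fps_linear_power_nth:
  "((fps_const u + fps_const c * fps_X) ^ n) $ k = of_nat (n choose k) * c ^ k * (u :: 'a::comm_ring_1) ^ (n - k)"
proof -
  have "(fps_const u + fps_const c * fps_X) ^ n =
      (\<Sum>i\<le>n. fps_const (of_nat (n choose i) * c ^ i * u ^ (n - i)) * fps_X ^ i)"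
    by (subst add.commute, subst binomial_ring)
       (auto intro!: sum.cong simp: power_mult_distrib fps_const_power fps_of_nat[symmetric] mult_ac
          simp flip: fps_const_mult)
  also have "\<dots> $ k = (\<Sum>i\<le>n. if i = k then of_nat (n choose k) * c ^ k * u ^ (n - k) else 0)"
    unfolding fps_sum_nth by (intro sum.cong) auto
  also have "\<dots> = of_nat (n choose k) * c ^ k * u ^ (n - k)"
    by (cases "k \<le> n") (auto simp: binomial_eq_0)
  finally show ?thesis .
qed

text \<open>Compare coefficients in \<open>(1 + X)^(m + a q) = (1 + X)^m (1 + X^q)^a\<close>. As
  \<open>m\<close> and \<open>n\<close> are below \<open>q\<close>, only the summand
  \<open>k = b\<close> of the second factor contributes.\<close>

lemma Lucas:
  fixes m n a b l :: nat
  assumes p: "prime CHAR('a::field)" and q: "q = CHAR('a) ^ l" and mn: "m < q" "n < q"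
  shows "(of_nat ((m + a * q) choose (n + b * q)) :: 'a) = of_nat (m choose n) * of_nat (a choose b)"
proof -
  let ?P = "1 + fps_X :: 'a fps"
  have nth: "(?P ^ k) $ i = of_nat (k choose i)" for k i
    using fps_linear_power_nth[of "1::'a" 1 k i] by simp
  have "?P ^ q = 1 + fps_X ^ q"
    using freshmans_dream'[of q l "1 :: 'a fps" fps_X] p q by simp
  hence "?P ^ (m + a * q) = ?P ^ m * (fps_X ^ q + 1) ^ a"
    by (simp add: power_add power_mult mult.commute[of a q] add.commute)
  also have "(fps_X ^ q + 1 :: 'a fps) ^ a = (\<Sum>k\<le>a. fps_const (of_nat (a choose k)) * fps_X ^ (q * k))"
    by (subst binomial_ring) (simp add: power_mult fps_of_nat)
  finally have "of_nat ((m + a * q) choose (n + b * q)) =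
      (?P ^ m * (\<Sum>k\<le>a. fps_const (of_nat (a choose k)) * fps_X ^ (q * k))) $ (n + b * q)"
    by (simp flip: nth)
  also have "\<dots> = (\<Sum>k\<le>a. of_nat (a choose k) *
      (if n + b * q < q * k then 0 else of_nat (m choose (n + b * q - q * k))))"
    by (simp add: sum_distrib_left fps_sum_nth mult.left_commute[of "?P ^ m"]
        fps_X_power_mult_right_nth nth cong: if_cong)
  also have "\<dots> = (\<Sum>k\<le>a. if k = b then of_nat (a choose b) * of_nat (m choose n) else 0)"
  proof (rule sum.cong[OF refl])
    fix k
    consider "k = b" | "k < b" | "k > b" by linarith
    thus "of_nat (a choose k) * (if n + b * q < q * k then 0 else of_nat (m choose (n + b * q - q * k)))
      = (if k = b then of_nat (a choose b) * of_nat (m choose n) else (0::'a))"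
    proof cases
      case 1 thus ?thesis by (simp add: mult.commute)
    next
      case 2
      hence "q * Suc k \<le> b * q" by (metis Suc_leI mult.commute mult_le_mono2)
      hence "m < n + b * q - q * k" using mn by simp
      thus ?thesis using 2 by (simp add: binomial_eq_0)
    next
      case 3
      hence "q * Suc b \<le> q * k" by (intro mult_le_mono2) simp
      hence "n + b * q < q * k" using mn by (simp add: mult.commute)
      thus ?thesis using 3 by simp
    qed
  qed
  also have "\<dots> = of_nat (m choose n) * of_nat (a choose b)"
    by (cases "b \<le> a") (auto simp: binomial_eq_0)
  finally show ?thesis .
qed

text \<open>The low block of the sum is \<open>j + m - q\<close>, which is smaller than
  \<open>j\<close>, so the low factor in Lucas' theorem is zero.\<close>

lemma of_nat_binomial_carry:
  assumes "prime CHAR('a::field)" and q: "q = CHAR('a) ^ l" and "j < q" "m < q" "j + m \<ge> q"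
  shows "(of_nat (((j + m) + a * q) choose (j + b * q)) :: 'a) = 0"
proof -
  have "(j + m) + a * q = (j + m - q) + Suc a * q" using assms by simp
  moreover have "j + m - q < q" "j + m - q < j" using assms by simp_all
  ultimately show ?thesis using Lucas[OF assms(1) q, of "j + m - q" j "Suc a" b] assms(3)
    by (simp only: binomial_eq_0) simp
qed

lemma fps_power_CHAR_nth:
  fixes f :: "'a::field fps"
  assumes p: "prime CHAR('a)"
  shows "(f ^ CHAR('a)) $ n = (if CHAR('a) dvd n then (f $ (n div CHAR('a))) ^ CHAR('a) else 0)"
proof -
  let ?p = "CHAR('a)"
  have p0: "?p > 0" using p prime_gt_0_nat by blast
  \<comment> \<open>Additivity of the Frobenius map is applied to finite sums, so \<open>f\<close>
    is cut after degree \<open>n\<close>; the p-th power of the tail starts beyond degree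
    \<open>n\<close>.\<close>
  have "f = fps_X ^ Suc n * fps_shift (Suc n) f + fps_cutoff (Suc n) f"
    by (rule fps_shift_cutoff'[symmetric])
  also have "fps_cutoff (Suc n) f = (\<Sum>i\<le>n. fps_const (f $ i) * fps_X ^ i)"
    by (intro fps_ext) (auto simp: fps_sum_nth if_distrib sum.delta cong: if_cong)
  also have "(fps_X ^ Suc n * fps_shift (Suc n) f + (\<Sum>i\<le>n. fps_const (f $ i) * fps_X ^ i)) ^ ?p
      = fps_X ^ (Suc n * ?p) * fps_shift (Suc n) f ^ ?p + (\<Sum>i\<le>n. fps_const ((f $ i) ^ ?p) * fps_X ^ (i * ?p))"
    using p by (simp add: freshmans_dream freshmans_dream_sum power_mult_distrib fps_const_power
        flip: power_mult del: power_Suc)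
  finally have "(f ^ ?p) $ n = (fps_X ^ (Suc n * ?p) * fps_shift (Suc n) f ^ ?p) $ n +
     (\<Sum>i\<le>n. if n = i * ?p then (f $ i) ^ ?p else 0)"
    by (simp add: fps_sum_nth if_distrib cong: if_cong)
  moreover have "n < Suc n * ?p" using p0 by (cases ?p) auto
  moreover have "(\<Sum>i\<le>n. if n = i * ?p then (f $ i) ^ ?p else 0) =
      (if ?p dvd n then (f $ (n div ?p)) ^ ?p else 0)"
  proof (cases "?p dvd n")
    case True
    hence "(n = i * ?p) = (i = n div ?p)" for i using p0 by auto
    hence "(\<Sum>i\<le>n. if n = i * ?p then (f $ i) ^ ?p else 0) = (\<Sum>i\<le>n. if i = n div ?p then (f $ i) ^ ?p else 0)"
      by simp
    thus ?thesis using True p0 by (simp add: sum.delta)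
  next
    case False
    hence "n \<noteq> i * ?p" for i by auto
    thus ?thesis using False by simp
  qed
  ultimately show ?thesis by (simp add: fps_X_power_mult_nth)
qed

section \<open>Subfields of the ambient field\<close>

lemma is_subfield_gen_field: "is_subfield (gen_field K S)"
  by (auto simp: is_subfield_def gen_field_def)

lemma gen_field_superset: "K \<union> S \<subseteq> gen_field K S"
  by (auto simp: gen_field_def)

lemma gen_field_least: "is_subfield E \<Longrightarrow> K \<union> S \<subseteq> E \<Longrightarrow> gen_field K S \<subseteq> E"
  by (auto simp: gen_field_def)

lemma subfield_closed:
  assumes "is_subfield E"
  shows "0 \<in> E" "1 \<in> E" "x \<in> E \<Longrightarrow> y \<in> E \<Longrightarrow> x + y \<in> E" "x \<in> E \<Longrightarrow> y \<in> E \<Longrightarrow> x * y \<in> E"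
    "x \<in> E \<Longrightarrow> - x \<in> E" "x \<in> E \<Longrightarrow> inverse x \<in> E" "x \<in> E \<Longrightarrow> x ^ n \<in> E"
proof -
  show "x \<in> E \<Longrightarrow> x ^ n \<in> E" using assms by (induction n) (auto simp: is_subfield_def)
qed (use assms in \<open>auto simp: is_subfield_def\<close>)

lemma subfield_sum: "is_subfield E \<Longrightarrow> (\<And>i. i \<in> A \<Longrightarrow> f i \<in> E) \<Longrightarrow> sum f A \<in> E"
  by (induction A rule: infinite_finite_induct) (auto intro: subfield_closed)

text \<open>Vandermonde's identity makes \<open>f \<mapsto> f(T + U)\<close> multiplicative.\<close>

lemma fps_shifted_mult_nth:
  fixes f g :: "'a::comm_ring_1 fps"
  shows "of_nat ((j + m) choose j) * (f * g) $ (j + m) =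
    (\<Sum>a\<le>j. \<Sum>b\<le>m. of_nat ((a + b) choose a) * f $ (a + b) *
       (of_nat ((j - a + (m - b)) choose (j - a)) * g $ (j - a + (m - b))))"
proof -
  let ?n = "j + m"
  let ?h = "\<lambda>(c, a). of_nat (c choose a) * of_nat ((?n - c) choose (j - a)) * (f $ c * g $ (?n - c))"
  have "of_nat (?n choose j) * (f * g) $ ?n =
      (\<Sum>c\<le>?n. of_nat (?n choose j) * (f $ c * g $ (?n - c)))"
    by (simp add: fps_mult_nth sum_distrib_left atLeast0AtMost)
  also have "\<dots> = (\<Sum>c\<le>?n. \<Sum>a\<le>j. ?h (c, a))"
  proof (rule sum.cong[OF refl])
    fix c assume "c \<in> {..?n}"
    hence "(?n choose j) = (\<Sum>a\<le>j. (c choose a) * ((?n - c) choose (j - a)))"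
      using vandermonde[of c "?n - c" j] by simp
    thus "of_nat (?n choose j) * (f $ c * g $ (?n - c)) = (\<Sum>a\<le>j. ?h (c, a))"
      by (simp add: sum_distrib_right)
  qed
  also have "\<dots> = sum ?h ({..?n} \<times> {..j})"
    by (simp add: sum.cartesian_product)
  \<comment> \<open>Substitution \<open>c = a + b\<close>. Pairs \<open>(c, a)\<close> not of this
    form have \<open>c < a\<close> or \<open>c - a > m\<close>, and there one of the two binomials
    vanishes.\<close>
  also have "\<dots> = sum ?h ((\<lambda>(a, b). (a + b, a)) ` ({..j} \<times> {..m}))"
  proof (rule sum.mono_neutral_right)
    show "\<forall>i\<in>{..?n} \<times> {..j} - (\<lambda>(a, b). (a + b, a)) ` ({..j} \<times> {..m}). ?h i = 0"
    proof
      fix i assume i: "i \<in> {..?n} \<times> {..j} - (\<lambda>(a, b). (a + b, a)) ` ({..j} \<times> {..m})"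
      obtain c a where [simp]: "i = (c, a)" by force
      have "c < a \<or> c - a > m"
      proof (rule ccontr)
        assume "\<not> ?thesis"
        hence "i = (\<lambda>(a, b). (a + b, a)) (a, c - a)" "(a, c - a) \<in> {..j} \<times> {..m}" using i by auto
        thus False using i by blast
      qed
      thus "?h i = 0" using i by (auto simp: binomial_eq_0)
    qed
  qed auto
  also have "\<dots> = (\<Sum>(a, b)\<in>{..j} \<times> {..m}. ?h (a + b, a))"
    by (subst sum.reindex) (auto simp: inj_on_def intro!: sum.cong)
  also have "\<dots> = (\<Sum>a\<le>j. \<Sum>b\<le>m. ?h (a + b, a))"
    by (simp add: sum.cartesian_product)
  also have "\<dots> = (\<Sum>a\<le>j. \<Sum>b\<le>m. of_nat ((a + b) choose a) * f $ (a + b) *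
       (of_nat ((j - a + (m - b)) choose (j - a)) * g $ (j - a + (m - b))))"
    by (intro sum.cong refl) (auto simp: mult_ac)
  finally show ?thesis .
qed

section \<open>Defects of iterativity as derivations\<close>

locale higher_deriv =
  fixes \<theta> :: "'a::field \<Rightarrow> 'a fps"
  assumes hd: "higher_derivation UNIV \<theta>"
begin

abbreviation D :: "nat \<Rightarrow> 'a \<Rightarrow> 'a" where "D \<equiv> hder \<theta>"

lemma theta_add: "\<theta> (x + y) = \<theta> x + \<theta> y" and theta_mult: "\<theta> (x * y) = \<theta> x * \<theta> y"
  and theta_1: "\<theta> 1 = 1" and D_0 [simp]: "D 0 x = x"
  using hd by (auto simp: higher_derivation_def hder_def)

lemma theta_power: "\<theta> (x ^ n) = \<theta> x ^ n"
  by (induction n) (auto simp: theta_1 theta_mult)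

lemma D_add: "D n (x + y) = D n x + D n y"
  by (simp add: hder_def theta_add)

lemma D_zero [simp]: "D n 0 = 0"
  using D_add[of n 0 0] by (metis add.right_neutral add_left_cancel)

lemma D_minus: "D n (- x) = - D n x"
proof -
  have "D n (- x) + D n x = 0" using D_add[of n "- x" x] by simp
  thus ?thesis by (simp only: eq_neg_iff_add_eq_0)
qed

lemma D_sum: "D n (sum f A) = (\<Sum>i\<in>A. D n (f i))"
  by (induction A rule: infinite_finite_induct) (auto simp: D_add)

lemma D_mult: "D n (x * y) = (\<Sum>i\<le>n. D i x * D (n - i) y)"
  by (simp add: hder_def theta_mult fps_mult_nth atLeast0AtMost)

lemma D_of_nat_mult: "D n (of_nat k * x) = of_nat k * D n x"
  by (induction k) (auto simp: D_add algebra_simps)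

lemma D_inverse_of_nat_mult: "D n (inverse (of_nat k) * x) = inverse (of_nat k) * D n x"
proof (cases "of_nat k = (0::'a)")
  case False
  have "D n x = of_nat k * D n (inverse (of_nat k) * x)"
    using False by (simp flip: D_of_nat_mult mult.assoc)
  thus ?thesis using False by simp
qed simp

lemma funpow_D_add: "(D n ^^ k) (x + y) = (D n ^^ k) x + (D n ^^ k) y"
  by (induction k) (auto simp: D_add)

lemma funpow_D_zero [simp]: "(D n ^^ k) 0 = 0"
  by (induction k) auto

lemma funpow_D_of_nat_mult: "(D n ^^ k) (of_nat c * x) = of_nat c * (D n ^^ k) x"
  by (induction k) (auto simp: D_of_nat_mult)

lemma funpow_D_inverse_of_nat_mult:
  "(D n ^^ k) (inverse (of_nat c) * x) = inverse (of_nat c) * (D n ^^ k) x"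
  by (induction k) (auto simp: D_inverse_of_nat_mult)

lemma D_D_mult:
  "D j (D m (x * y)) = (\<Sum>a\<le>j. \<Sum>b\<le>m. D a (D b x) * D (j - a) (D (m - b) y))"
proof -
  have "D j (D m (x * y)) = (\<Sum>b\<le>m. \<Sum>a\<le>j. D a (D b x) * D (j - a) (D (m - b) y))"
    by (subst D_mult, subst D_sum) (simp add: D_mult)
  thus ?thesis by (subst sum.swap)
qed

definition defect :: "nat \<Rightarrow> nat \<Rightarrow> 'a \<Rightarrow> 'a" where
  "defect j m y = D j (D m y) - of_nat ((j + m) choose j) * D (j + m) y"

definition iter_upto :: "nat \<Rightarrow> 'a set \<Rightarrow> bool" where
  "iter_upto n X \<longleftrightarrow> (\<forall>y\<in>X. \<forall>j m. j + m \<le> n \<longrightarrow> defect j m y = 0)"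

lemma defect_add: "defect j m (x + y) = defect j m x + defect j m y"
  by (simp add: defect_def D_add algebra_simps)

lemma defect_0 [simp]: "defect 0 m y = 0" "defect j 0 y = 0"
  by (simp_all add: defect_def)

text \<open>Both \<open>\<theta>\<^sub>U \<circ> \<theta>\<^sub>T\<close> and \<open>\<theta>\<^bsub>T+U\<^esub>\<close> are multiplicative, so the leading
  terms of their difference are derivations.\<close>

lemma defect_mult:
  assumes "iter_upto n {x, y}" and jm: "j + m = Suc n"
  shows "defect j m (x * y) = defect j m x * y + x * defect j m y"
proof -
  let ?P = "\<lambda>a b z. of_nat ((a + b) choose a) * D (a + b) z"
  let ?h = "\<lambda>(a, b). D a (D b x) * D (j - a) (D (m - b) y) - ?P a b x * ?P (j - a) (m - b) y"
  have *: "D a (D b z) = ?P a b z" if "a + b < Suc n" "z = x \<or> z = y" for a b z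
    using assms that by (auto simp: iter_upto_def defect_def)
  have "defect j m (x * y) = (\<Sum>a\<le>j. \<Sum>b\<le>m. ?h (a, b))"
    unfolding defect_def D_D_mult using fps_shifted_mult_nth[of j m "\<theta> x" "\<theta> y"]
    by (simp add: hder_def theta_mult sum_subtractf add_ac)
  also have "\<dots> = sum ?h ({..j} \<times> {..m})"
    by (simp only: sum.cartesian_product case_prod_eta)
  \<comment> \<open>Away from these two corners both factors have total order at most
    \<open>n\<close>, where the hypothesis identifies the two products.\<close>
  also have "\<dots> = sum ?h {(0, 0), (j, m)}"
  proof (rule sum.mono_neutral_right)
    show "\<forall>i\<in>{..j} \<times> {..m} - {(0, 0), (j, m)}. ?h i = 0"
    proof
      fix i assume i: "i \<in> {..j} \<times> {..m} - {(0, 0), (j, m)}"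
      obtain a b where [simp]: "i = (a, b)" by force
      have "a + b < Suc n" "j - a + (m - b) < Suc n" using i jm by auto
      thus "?h i = 0" by (simp add: *)
    qed
  qed auto
  also have "\<dots> = ?h (0, 0) + ?h (j, m)"
    using jm by (subst sum.insert) auto
  also have "\<dots> = defect j m x * y + x * defect j m y"
    by (simp add: defect_def algebra_simps)
  finally show ?thesis .
qed

end

text \<open>The rules are assumed on \<open>K\<close> alone, since a defect is known to be a
  derivation only where the defects of lower order vanish. For inverses, apply \<open>d\<close> to
  \<open>x * inverse x = 1\<close>.\<close>

lemma derivation_kernel_subfield:
  fixes d :: "'a::field \<Rightarrow> 'a"
  assumes K: "is_subfield K"
    and add: "\<And>x y. x \<in> K \<Longrightarrow> y \<in> K \<Longrightarrow> d (x + y) = d x + d y"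
    and mult: "\<And>x y. x \<in> K \<Longrightarrow> y \<in> K \<Longrightarrow> d (x * y) = d x * y + x * d y"
  shows "is_subfield {y \<in> K. d y = 0}"
proof -
  note K' = subfield_closed[OF K]
  have d0: "d 0 = 0" using add[of 0 0] K' by (metis add.right_neutral add_left_cancel)
  have d1: "d 1 = 0" using mult[of 1 1] K' by (metis add.right_neutral add_left_cancel mult_1 mult_1_right)
  have "d (- x) = 0" if "x \<in> K" "d x = 0" for x
    using add[of x "- x"] that K' d0 by simp
  moreover have "d (inverse x) = 0" if "x \<in> K" "d x = 0" for x
  proof (cases "x = 0")
    case False
    thus ?thesis using mult[of x "inverse x"] that K' d1 by simp
  qed (simp add: d0)
  ultimately show ?thesis using K' d0 d1 add mult by (auto simp: is_subfield_def)
qed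

text \<open>If \<open>d\<close> kills the coefficients of \<open>q\<close>, then
  \<open>d (q(y)) = q'(y) d y\<close>, and coprimality of \<open>q\<close> and
  \<open>pderiv q\<close> makes \<open>q'(y)\<close> nonzero at a root.\<close>

lemma derivation_separable_zero:
  fixes d :: "'a::field \<Rightarrow> 'a"
  assumes add: "\<And>x y. d (x + y) = d x + d y"
    and mult: "\<And>x y. d (x * y) = d x * y + x * d y"
    and E: "\<And>x. x \<in> E \<Longrightarrow> d x = 0" and sep: "separable_over E y"
  shows "d y = 0"
proof -
  have d0: "d 0 = 0" using add[of 0 0] by (metis add.right_neutral add_left_cancel)
  have chain: "d (poly q y) = poly (pderiv q) y * d y" if "\<And>i. coeff q i \<in> E" for q
    using that
  proof (induction q)
    case (pCons a q)
    have "d a = 0" using E pCons.prems[of 0] by simp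
    moreover have "coeff q i \<in> E" for i using pCons.prems[of "Suc i"] by simp
    ultimately show ?case using pCons.IH
      by (simp add: add mult pderiv_pCons algebra_simps)
  qed (simp add: d0)
  obtain q where q: "\<And>i. coeff q i \<in> E" "poly q y = 0" "coprime q (pderiv q)"
    using sep by (auto simp: separable_over_def)
  have "poly (pderiv q) y \<noteq> 0" using coprime_poly_0[OF q(3), of y] q(2) by auto
  thus ?thesis using chain[OF q(1)] q(2) d0 by simp
qed

context higher_deriv
begin

text \<open>Induction on the order: once the defects up to order \<open>n\<close> vanish on the
  field, those of order \<open>n + 1\<close> are derivations there, and their kernels are subfields
  containing the generators.\<close>

lemma iter_upto_gen_field:
  assumes "iter_upto n (F \<union> S)"
  shows "iter_upto n (gen_field F S)"
  using assms
proof (induction n)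
  case (Suc n)
  let ?K = "gen_field F S"
  have IH: "iter_upto n ?K" using Suc by (auto simp: iter_upto_def)
  have "defect j m y = 0" if y: "y \<in> ?K" and jm: "j + m = Suc n" for j m y
  proof -
    have "is_subfield {y \<in> ?K. defect j m y = 0}"
      using IH by (intro derivation_kernel_subfield is_subfield_gen_field defect_add
        defect_mult[OF _ jm]) (auto simp: iter_upto_def)
    moreover have "F \<union> S \<subseteq> {y \<in> ?K. defect j m y = 0}"
      using gen_field_superset[of F S] Suc.prems jm by (auto simp: iter_upto_def)
    ultimately show ?thesis using gen_field_least[of _ F S] y by blast
  qed
  thus ?case using IH by (auto simp: iter_upto_def le_Suc_eq)
qed (auto simp: iter_upto_def)

lemma iter_upto_separable:
  assumes "iter_upto n E" and sep: "\<And>y. separable_over E y"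
  shows "iter_upto n UNIV"
  using assms(1)
proof (induction n)
  case (Suc n)
  have IH: "iter_upto n UNIV" using Suc by (auto simp: iter_upto_def)
  have "defect j m y = 0" if jm: "j + m = Suc n" for j m y
  proof (rule derivation_separable_zero[OF defect_add _ _ sep])
    show "defect j m (x * y) = defect j m x * y + x * defect j m y" for x y
      using IH by (intro defect_mult[OF _ jm]) (auto simp: iter_upto_def)
  qed (use Suc.prems jm in \<open>auto simp: iter_upto_def\<close>)
  thus ?case using IH by (auto simp: iter_upto_def le_Suc_eq)
qed (auto simp: iter_upto_def)

section \<open>Sets stable under the operators\<close>

definition stable :: "'a set \<Rightarrow> bool" where
  "stable X \<longleftrightarrow> (\<forall>y\<in>X. \<forall>n. D n y \<in> X)"

lemma stable_D: "stable X \<Longrightarrow> y \<in> X \<Longrightarrow> D n y \<in> X"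
  by (simp add: stable_def)

lemma stable_funpow_D: "stable X \<Longrightarrow> y \<in> X \<Longrightarrow> (D n ^^ k) y \<in> X"
  by (induction k) (auto intro: stable_D)

lemma D_one: "D n 1 = (if n = 0 then 1 else 0)"
  by (simp add: hder_def theta_1)

lemma stable_gen_field:
  assumes "\<And>y n. y \<in> F \<union> S \<Longrightarrow> D n y \<in> gen_field F S"
  shows "stable (gen_field F S)"
proof -
  let ?K = "gen_field F S"
  note K = subfield_closed[OF is_subfield_gen_field[of F S]]
  let ?E = "{y \<in> ?K. \<forall>n. D n y \<in> ?K}"
  have inv: "D n (inverse y) \<in> ?K" if y: "y \<in> ?E" for y n
  proof (cases "y = 0")
    case False
    show ?thesis
    proof (induction n rule: less_induct)
      case (less n)
      show ?case
      proof (cases n)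
        case (Suc k)
        let ?S = "\<Sum>i\<le>k. D i (inverse y) * D (n - i) y"
        \<comment> \<open>Expanding this product determines \<open>D n (inverse y)\<close>
          recursively from lower orders, which already lie in the field.\<close>
        have "D n (inverse y * y) = 0" using False Suc by (simp add: D_one)
        hence "?S + D n (inverse y) * y = 0" unfolding D_mult using Suc by simp
        hence "D n (inverse y) * y = - ?S" by (simp only: eq_neg_iff_add_eq_0 add.commute)
        hence "D n (inverse y) = - ?S * inverse y"
          using False by (metis mult.assoc mult.right_neutral right_inverse)
        also have "\<dots> \<in> ?K"
          using less.IH y Suc
          by (intro K subfield_sum[OF is_subfield_gen_field]) auto
        finally show ?thesis .
      qed (use y K in auto)
    qed
  qed (use K in auto)
  have "is_subfield ?E"
    unfolding is_subfield_def using K inv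
    by (auto simp: D_add D_mult D_minus D_one intro!: subfield_sum[OF is_subfield_gen_field])
  moreover have "F \<union> S \<subseteq> ?E" using assms gen_field_superset by blast
  ultimately show ?thesis using gen_field_least[of ?E F S] by (auto simp: stable_def)
qed

end

section \<open>Operators on p-th powers\<close>

locale higher_deriv_char = higher_deriv \<theta> for \<theta> :: "'a::field \<Rightarrow> 'a fps" +
  fixes p :: nat
  assumes prime_p: "prime p" and char_p: "CHAR('a) = p"
begin

lemma p_gt_1: "p > 1"
  by (rule prime_gt_1_nat[OF prime_p])

lemma p_pos: "p > 0"
  by (rule prime_gt_0_nat[OF prime_p])

lemma of_nat_p [simp]: "of_nat p = (0::'a)"
  using of_nat_CHAR[where 'a='a] char_p by simp

lemma of_nat_fact_neq_0: "a < p \<Longrightarrow> of_nat (fact a) \<noteq> (0::'a)"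
  using prime_dvd_fact_iff[OF prime_p, of a] char_p by (simp add: of_nat_eq_0_iff_char_dvd del: of_nat_fact)

lemma lucas:
  "m < p ^ l \<Longrightarrow> n < p ^ l \<Longrightarrow>
    (of_nat ((m + a * p ^ l) choose (n + b * p ^ l)) :: 'a) = of_nat (m choose n) * of_nat (a choose b)"
  using Lucas[where 'a='a, of "p ^ l" l m n a b] prime_p char_p by simp

lemma binomial_carry:
  "j < p ^ l \<Longrightarrow> m < p ^ l \<Longrightarrow> p ^ l \<le> j + m \<Longrightarrow> (of_nat (((j + m) + a * p ^ l) choose (j + b * p ^ l)) :: 'a) = 0"
  using of_nat_binomial_carry[where 'a='a, of "p ^ l" l j m a b] prime_p char_p by simp

lemma D_power_p: "D n (y ^ p) = (if p dvd n then D (n div p) y ^ p else 0)"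
  using fps_power_CHAR_nth[of "\<theta> y" n] prime_p char_p by (simp add: hder_def theta_power)

lemma of_nat_power_p: "(of_nat k :: 'a) ^ p = of_nat k"
proof (induction k)
  case (Suc k)
  have "(1 + of_nat k :: 'a) ^ p = 1 ^ p + of_nat k ^ p"
    by (rule freshmans_dream) (simp_all add: prime_p char_p)
  thus ?case using Suc by simp
qed (use p_pos in simp)

text \<open>On p-th powers only orders divisible by \<open>p\<close> survive. If \<open>p\<close>
  divides \<open>j\<close> and \<open>m\<close>, the identity is the p-th power of the one of order
  \<open>(j/p, m/p)\<close>. Otherwise both sides vanish; when \<open>p\<close> divides
  \<open>j + m\<close> but not \<open>m\<close>, a carry kills the binomial.\<close>

lemma iter_upto_power_p:
  assumes "iter_upto n UNIV"
  shows "iter_upto (p * n) {y ^ p | y. True}"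
  unfolding iter_upto_def
proof (safe)
  fix y j m assume jm: "j + m \<le> p * n"
  show "defect j m (y ^ p) = 0"
  proof (cases "p dvd m")
    case m: True
    then obtain m' where [simp]: "m = p * m'" by blast
    show ?thesis
    proof (cases "p dvd j")
      case True
      then obtain j' where [simp]: "j = p * j'" by blast
      have "j' + m' \<le> n" using jm p_pos by (simp flip: distrib_left)
      hence "defect j' m' y = 0" using assms by (auto simp: iter_upto_def)
      hence "D j (D m (y ^ p)) = (of_nat ((j' + m') choose j') * D (j' + m') y) ^ p"
        using p_pos by (simp add: D_power_p defect_def)
      also have "\<dots> = of_nat ((j + m) choose j) * D (j + m) (y ^ p)"
      proof -
        have jm': "j + m = p * (j' + m')" by (simp add: distrib_left)
        have "of_nat ((p * (j' + m')) choose (p * j')) = (of_nat ((j' + m') choose j') :: 'a)"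
          using lucas[of 0 1 0 "j' + m'" j'] p_pos by (simp add: mult.commute)
        thus ?thesis
          unfolding jm' using p_pos by (simp add: D_power_p power_mult_distrib of_nat_power_p)
      qed
      finally show ?thesis by (simp add: defect_def)
    next
      case False
      hence "\<not> p dvd j + m" using m by (simp add: dvd_add_left_iff)
      thus ?thesis using m False by (simp add: D_power_p defect_def)
    qed
  next
    case m: False
    show ?thesis
    proof (cases "p dvd j + m")
      case True
      have "j mod p + m mod p \<ge> p"
      proof (rule ccontr)
        assume "\<not> ?thesis"
        hence "(j + m) mod p = j mod p + m mod p" using mod_add_eq[of j p m] by simp
        thus False using True m by (simp add: dvd_eq_mod_eq_0)
      qed
      hence "of_nat (((j mod p + m mod p) + (j div p + m div p) * p) choose (j mod p + j div p * p)) = (0::'a)"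
        using binomial_carry[of "j mod p" 1 "m mod p" "j div p + m div p" "j div p"] p_pos by simp
      also have "(j mod p + m mod p) + (j div p + m div p) * p = j + m"
        using mod_mult_div_eq[of j p] mod_mult_div_eq[of m p] by (simp add: algebra_simps)
      finally show ?thesis using m by (simp add: defect_def D_power_p)
    qed (use m in \<open>simp add: defect_def D_power_p\<close>)
  qed
qed

end

section \<open>The operators of p-power order\<close>

lemma funpow_commute_on:
  assumes X: "\<And>z. z \<in> X \<Longrightarrow> f z \<in> X" "\<And>z. z \<in> X \<Longrightarrow> g z \<in> X"
    and comm: "\<And>z. z \<in> X \<Longrightarrow> f (g z) = g (f z)" and z: "z \<in> X"
  shows "(f ^^ a) ((g ^^ b) z) = (g ^^ b) ((f ^^ a) z)"
proof -
  have fX: "(f ^^ a) w \<in> X" and gX: "(g ^^ a) w \<in> X" if "w \<in> X" for a w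
    using that X by (induction a) auto
  have *: "f ((g ^^ b) w) = (g ^^ b) (f w)" if "w \<in> X" for w
    using that by (induction b) (auto simp: comm gX)
  show ?thesis by (induction a) (auto simp: * fX z)
qed

context higher_deriv_char
begin

text \<open>Bounding \<open>j\<close> and \<open>m\<close> separately lets \<open>j + m\<close>
  exceed \<open>n\<close>. For \<open>n = p ^ l\<close> this includes the vanishing of
  \<open>D j (D m y)\<close> whenever \<open>j + m\<close> reaches \<open>n\<close>, on which the
  truncation of Taylor series rests.\<close>

definition iter_below :: "nat \<Rightarrow> 'a set \<Rightarrow> bool" where
  "iter_below n X \<longleftrightarrow> (\<forall>y\<in>X. \<forall>j<n. \<forall>m<n. defect j m y = 0)"

definition level :: "nat \<Rightarrow> 'a set \<Rightarrow> bool" where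
  "level l X \<longleftrightarrow>
     (\<forall>m a. m < p ^ l \<and> 0 < a \<and> a < p \<longrightarrow>
        (\<forall>y\<in>X. D (m + a * p ^ l) y = inverse (of_nat (fact a)) * (D (p ^ l) ^^ a) (D m y))) \<and>
     (\<forall>y\<in>X. (D (p ^ l) ^^ p) y = 0) \<and>
     (\<forall>j<l. \<forall>y\<in>X. D (p ^ j) (D (p ^ l) y) = D (p ^ l) (D (p ^ j) y))"

lemma level_pointwise: "level l X \<longleftrightarrow> (\<forall>y\<in>X. level l {y})"
proof
  show "level l X \<Longrightarrow> \<forall>y\<in>X. level l {y}"
    by (simp add: level_def del: of_nat_fact)
  show "\<forall>y\<in>X. level l {y} \<Longrightarrow> level l X"
    by (simp add: level_def del: of_nat_fact)
qed

lemma cond1_iff_iter_upto: "cond1 \<theta> p l0 X \<longleftrightarrow> iter_upto (p ^ Suc l0) X"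
proof -
  have "cond1 \<theta> p l0 X \<longleftrightarrow>
      (\<forall>y\<in>X. \<forall>j m. 0 < j \<and> 0 < m \<and> j + m \<le> p ^ Suc l0 \<longrightarrow> defect j m y = 0)"
    unfolding cond1_def defect_def right_minus_eq by auto
  also have "\<dots> \<longleftrightarrow> iter_upto (p ^ Suc l0) X"
    unfolding iter_upto_def by (metis defect_0 gr0I)
  finally show ?thesis .
qed

lemma cond2_iff_level: "cond2 \<theta> p l0 X \<longleftrightarrow> (\<forall>l<Suc l0. level l X)"
  unfolding cond2_def level_def less_Suc_eq_le ..

text \<open>All compositions involved have total order at most \<open>p ^ Suc l\<close>. With
  \<open>q = p ^ l\<close>, Lucas gives the factor \<open>i + 1\<close> for the step from
  \<open>m + i q\<close> to \<open>m + (i + 1) q\<close>, so powers of \<open>D q\<close> build up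
  factorials and the p-th power meets the factor \<open>p = 0\<close>.\<close>

lemma iter_upto_level:
  assumes X: "iter_upto (p ^ Suc l) X"
  shows "level l X"
proof -
  let ?q = "p ^ l"
  have DD: "D j (D m y) = of_nat ((j + m) choose j) * D (j + m) y" if "y \<in> X" "j + m \<le> p * ?q" for j m y
    using X that by (auto simp: iter_upto_def defect_def)
  have q0: "?q > 0" using p_pos by simp
  have step: "D ?q (D (m + i * ?q) y) = of_nat (Suc i) * D (m + Suc i * ?q) y"
    if "y \<in> X" "m < ?q" "Suc i < p" for m i y
  proof -
    have "Suc (Suc i) * ?q \<le> p * ?q" using that by (intro mult_le_mono1) simp
    hence "?q + (m + i * ?q) \<le> p * ?q" using that by simp
    moreover have "of_nat ((?q + (m + i * ?q)) choose ?q) = (of_nat (Suc i) :: 'a)"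
      using lucas[of m l 0 "Suc i" 1] that(2) q0 by (simp add: add_ac)
    ultimately show ?thesis using DD[OF that(1), of ?q "m + i * ?q"] by (simp add: add_ac)
  qed
  have pow: "(D ?q ^^ a) (D m y) = of_nat (fact a) * D (m + a * ?q) y"
    if "y \<in> X" "m < ?q" "a < p" for m a y
    using that(3)
  proof (induction a)
    case (Suc a)
    hence "(D ?q ^^ Suc a) (D m y) = of_nat (fact a) * D ?q (D (m + a * ?q) y)"
      by (simp add: D_of_nat_mult del: of_nat_fact)
    also have "\<dots> = of_nat (fact (Suc a)) * D (m + Suc a * ?q) y"
      by (simp only: step[OF that(1,2) Suc.prems] fact_Suc of_nat_mult of_nat_id mult_ac)
    finally show ?case .
  qed simp
  have "D (m + a * ?q) y = inverse (of_nat (fact a)) * (D ?q ^^ a) (D m y)"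
    if "m < ?q" "a < p" "y \<in> X" for m a y
    using pow[of y m a] of_nat_fact_neq_0[of a] that by (simp del: of_nat_fact)
  moreover have "(D ?q ^^ p) y = 0" if y: "y \<in> X" for y
  proof -
    obtain a where a: "p = Suc a" using p_pos gr0_implies_Suc by blast
    have "(D ?q ^^ p) y = of_nat (fact a) * D ?q (D (a * ?q) y)"
      using pow[of y 0 a] y q0 a by (simp add: D_of_nat_mult del: of_nat_fact)
    also have "D ?q (D (a * ?q) y) = of_nat ((p * ?q) choose ?q) * D (p * ?q) y"
      using DD[OF y, of ?q "a * ?q"] a by simp
    also have "of_nat ((p * ?q) choose ?q) = (0 :: 'a)"
      using lucas[of 0 l 0 p 1] q0 by simp
    finally show ?thesis by simp
  qed
  moreover have "D (p ^ j) (D ?q y) = D ?q (D (p ^ j) y)" if "j < l" "y \<in> X" for j y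
  proof -
    have "p ^ j \<le> ?q" using that p_gt_1 by (intro power_increasing) auto
    hence "p ^ j + ?q \<le> 2 * ?q" by simp
    also have "\<dots> \<le> p * ?q" using p_gt_1 by (intro mult_le_mono1) simp
    finally show ?thesis
      using DD[OF that(2), of "p ^ j" ?q] DD[OF that(2), of ?q "p ^ j"]
        binomial_symmetric[of "p ^ j" "p ^ j + ?q"] by (simp add: add_ac)
  qed
  ultimately show ?thesis by (auto simp: level_def)
qed

text \<open>Split \<open>j\<close> and \<open>m\<close> at \<open>q = p ^ l\<close>. Part (a) of (2)
  turns the top digits into powers of \<open>D q\<close>, part (c) moves these past the low parts,
  and \<open>below\<close> treats the low parts. Stability lets the conditions be used at
  intermediate values.\<close>

lemma iter_below_Suc:
  assumes X: "stable X" and below: "iter_below (p ^ l) X" and level: "\<And>i. i \<le> l \<Longrightarrow> level i X"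
  shows "iter_below (p ^ Suc l) X"
proof -
  let ?q = "p ^ l"
  have q0: "?q > 0" using p_pos by simp
  note XD = stable_D[OF X] and XP = stable_funpow_D[OF X]
  have digit: "D (m + a * p ^ i) z = inverse (of_nat (fact a)) * (D (p ^ i) ^^ a) (D m z)"
    if "i \<le> l" "m < p ^ i" "a < p" "z \<in> X" for m a z i
    using level[OF that(1)] that by (cases "a = 0") (auto simp: level_def)
  \<comment> \<open>Part (c) covers only orders that are powers of \<open>p\<close>; peeling off the
    leading base-p digit of \<open>j\<close> extends it to every \<open>j < p ^ i\<close>.\<close>
  have comm: "D ?q (D j z) = D j (D ?q z)" if "i \<le> l" "j < p ^ i" "z \<in> X" for i j z
    using that
  proof (induction i arbitrary: j z)
    case (Suc i)
    let ?r = "p ^ i"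
    define j0 a where "j0 = j mod ?r" and "a = j div ?r"
    have j: "j = j0 + a * ?r" by (simp only: j0_def a_def mod_div_mult_eq)
    have j0: "j0 < ?r" using p_pos by (simp add: j0_def)
    have a: "a < p" using Suc.prems(2) by (simp add: a_def less_mult_imp_div_less)
    have qr: "D ?q (D ?r w) = D ?r (D ?q w)" if "w \<in> X" for w
      using level[of l] that Suc.prems(1) by (simp add: level_def)
    have "D ?q (D j z) = inverse (of_nat (fact a)) * (D ?q ^^ 1) ((D ?r ^^ a) (D j0 z))"
      using digit[of i j0 a z] j j0 a Suc.prems
      by (simp add: D_inverse_of_nat_mult del: of_nat_fact)
    also have "(D ?q ^^ 1) ((D ?r ^^ a) (D j0 z)) = (D ?r ^^ a) ((D ?q ^^ 1) (D j0 z))"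
      using Suc.prems(3) by (intro funpow_commute_on[of X]) (auto intro: XD qr)
    also have "(D ?q ^^ 1) (D j0 z) = D j0 (D ?q z)"
      using Suc.IH[of j0 z] j0 Suc.prems by simp
    finally show ?case using digit[of i j0 a "D ?q z"] j j0 a Suc.prems XD by simp
  qed simp
  have pow_p: "(D ?q ^^ n) z = 0" if "n \<ge> p" "z \<in> X" for n z
  proof -
    have "(D ?q ^^ n) z = (D ?q ^^ (n - p)) ((D ?q ^^ p) z)"
      using that by (simp flip: funpow_add[THEN fun_cong, simplified o_def])
    thus ?thesis using level[of l] that by (simp add: level_def)
  qed
  show ?thesis unfolding iter_below_def
  proof (intro ballI allI impI)
    fix y j m assume y: "y \<in> X" and jm: "j < p ^ Suc l" "m < p ^ Suc l"
    define j0 a m0 b where defs: "j0 = j mod ?q" "a = j div ?q" "m0 = m mod ?q" "b = m div ?q"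
    have j: "j = j0 + a * ?q" and m: "m = m0 + b * ?q" by (simp_all only: defs mod_div_mult_eq)
    have lt: "j0 < ?q" "m0 < ?q" using q0 by (simp_all add: defs)
    have ab: "a < p" "b < p" using jm by (simp_all add: defs less_mult_imp_div_less)
    let ?c = "inverse (of_nat (fact a)) * inverse (of_nat (fact b)) :: 'a"
    have "D j (D m y) = inverse (of_nat (fact a)) * (D ?q ^^ a) (D j0 (D m y))"
      unfolding j using digit[of l j0 a "D m y"] lt ab y XD by simp
    also have "D j0 (D m y) = inverse (of_nat (fact b)) * D j0 ((D ?q ^^ b) (D m0 y))"
      unfolding m using digit[of l m0 b y] lt ab y by (simp add: D_inverse_of_nat_mult del: of_nat_fact)
    also have "D j0 ((D ?q ^^ b) (D m0 y)) = (D ?q ^^ b) (D j0 (D m0 y))"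
      using funpow_commute_on[of X "D ?q" "D j0" "D m0 y" b 1] comm[of l j0] lt y XD by simp
    also have "D j0 (D m0 y) = of_nat ((j0 + m0) choose j0) * D (j0 + m0) y"
      using below lt y by (auto simp: iter_below_def defect_def)
    finally have DD: "D j (D m y) =
        ?c * of_nat ((j0 + m0) choose j0) * (D ?q ^^ (a + b)) (D (j0 + m0) y)"
      by (simp add: funpow_D_inverse_of_nat_mult funpow_D_of_nat_mult funpow_add mult.assoc del: of_nat_fact)
    have jm_eq: "j + m = (j0 + m0) + (a + b) * ?q" by (simp add: j m algebra_simps)
    \<comment> \<open>A carry from the low parts kills both binomials. A carry from the top digits
      kills one side by its binomial and the other by the vanishing p-th power of
      \<open>D ?q\<close>. Without a carry the factorials combine.\<close>
    have "D j (D m y) = of_nat ((j + m) choose j) * D (j + m) y"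
    proof (cases "j0 + m0 \<ge> ?q")
      case True
      have "of_nat ((j0 + m0) choose j0) = (0::'a)"
        using binomial_carry[of j0 l m0 0 0] True lt by simp
      moreover have "of_nat ((j + m) choose j) = (0::'a)"
        using binomial_carry[of j0 l m0 "a + b" a] True lt by (simp only: jm_eq flip: j)
      ultimately show ?thesis using DD by simp
    next
      case False
      have C: "of_nat ((j + m) choose j) = (of_nat ((j0 + m0) choose j0) * of_nat ((a + b) choose a) :: 'a)"
        using lucas[of "j0 + m0" l j0 "a + b" a] False lt by (simp only: jm_eq flip: j)
      show ?thesis
      proof (cases "a + b \<ge> p")
        case True
        have "of_nat ((a + b) choose a) = (0::'a)"
          using binomial_carry[of a 1 b 0 0] True ab by simp
        thus ?thesis using DD C pow_p[OF True XD[OF y]] by simp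
      next
        case ab': False
        have nz: "of_nat (fact n) \<noteq> (0::'a)" if "n \<le> a + b" for n
          using of_nat_fact_neq_0[of n] ab' that by simp
        have "fact a * fact b * ((a + b) choose a) = (fact (a + b) :: nat)"
          using binomial_fact_lemma[of a "a + b"] by simp
        hence "of_nat (fact (a + b)) =
            (of_nat (fact a) * of_nat (fact b) * of_nat ((a + b) choose a) :: 'a)"
          by (metis of_nat_mult)
        hence c: "of_nat ((a + b) choose a) = ?c * of_nat (fact (a + b))"
          using nz[of a] nz[of b] by (simp add: field_simps del: of_nat_fact)
        have "D (j + m) y = inverse (of_nat (fact (a + b))) * (D ?q ^^ (a + b)) (D (j0 + m0) y)"
          unfolding jm_eq using digit[of l "j0 + m0" "a + b" y] False ab' y by simp
        thus ?thesis using DD C c nz[of "a + b"] by (simp del: of_nat_fact)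
      qed
    qed
    thus "defect j m y = 0" by (simp add: defect_def)
  qed
qed

lemma iter_below_level:
  assumes "stable X" "\<And>i. i < l \<Longrightarrow> level i X"
  shows "iter_below (p ^ l) X"
  using assms(2)
proof (induction l)
  case (Suc l)
  thus ?case using assms(1) by (intro iter_below_Suc) auto
qed (auto simp: iter_below_def)

lemma iter_below_imp_iter_upto:
  assumes "iter_below n X"
  shows "iter_upto n X"
  unfolding iter_upto_def
proof (intro ballI allI impI)
  fix y j m assume "y \<in> X" "j + m \<le> n"
  thus "defect j m y = 0"
    using assms by (cases "j = 0"; cases "m = 0") (auto simp: iter_below_def)
qed

lemma iter_upto_mono: "iter_upto n X \<Longrightarrow> m \<le> n \<Longrightarrow> iter_upto m X"
  by (auto simp: iter_upto_def)

lemma iter_upto_imp_level: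
  assumes "iter_upto (p ^ l) X" "i < l"
  shows "level i X"
proof (rule iter_upto_level, rule iter_upto_mono[OF assms(1)])
  show "p ^ Suc i \<le> p ^ l" using assms(2) p_pos by (intro power_increasing) auto
qed

lemma iter_upto_iff_level: "stable X \<Longrightarrow> iter_upto (p ^ l) X \<longleftrightarrow> (\<forall>i<l. level i X)"
  using iter_upto_imp_level iter_below_level iter_below_imp_iter_upto by blast

text \<open>Descending to the levels and climbing back turns a bound on \<open>j + m\<close> into
  separate bounds on \<open>j\<close> and \<open>m\<close>.\<close>

lemma iter_upto_imp_iter_below: "stable X \<Longrightarrow> iter_upto (p ^ l) X \<Longrightarrow> iter_below (p ^ l) X"
  using iter_upto_imp_level iter_below_level by blast

lemma D_D_carry:
  assumes "iter_below (p ^ l) X" "y \<in> X" "j < p ^ l" "m < p ^ l" "j + m \<ge> p ^ l"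
  shows "D j (D m y) = 0"
  using assms binomial_carry[of j l m 0 0] by (simp add: iter_below_def defect_def)

section \<open>Truncated Taylor series at minus t\<close>

text \<open>The untruncated series \<open>\<theta>(x)\<close> at \<open>T = -t\<close> would be a constant.\<close>

definition taylor :: "'a \<Rightarrow> nat \<Rightarrow> 'a \<Rightarrow> 'a" where
  "taylor t q x = (\<Sum>m<q. D m x * (- t) ^ m)"

lemma D_minus_t_power:
  assumes "\<theta> t = fps_const t + fps_X"
  shows "D n ((- t) ^ m) = of_nat (m choose n) * (- 1) ^ n * (- t) ^ (m - n)"
proof -
  have "\<theta> (- t) = - \<theta> t"
    using D_minus[of _ t] by (intro fps_ext) (simp add: hder_def)
  hence "\<theta> (- t) = fps_const (- t) + fps_const (- 1) * fps_X"
    using assms by (simp flip: fps_const_neg)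
  thus ?thesis by (simp only: hder_def theta_power fps_linear_power_nth)
qed

text \<open>In the Leibniz expansion the inner sum for each \<open>a\<close> is the same
  \<open>W\<close>, up to a sign and the factor \<open>i choose a\<close>; the alternating sum of
  these factors is zero because \<open>i > 0\<close>.\<close>

lemma D_taylor:
  assumes t: "\<theta> t = fps_const t + fps_X" and below: "iter_below (p ^ l) UNIV"
    and i: "0 < i" "i < p ^ l"
  shows "D i (taylor t (p ^ l) x) = 0"
proof -
  let ?q = "p ^ l"
  let ?G = "\<lambda>s. of_nat (s choose i) * D s x * (- t) ^ (s - i)"
  define W where "W = (\<Sum>s<?q. ?G s)"
  have inner: "(\<Sum>m<?q. D a (D m x) * D (i - a) ((- t) ^ m)) =
      ((- 1) ^ i * ((- 1) ^ a * of_nat (i choose a))) * W" if a: "a \<le> i" for a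
  proof -
    have sgn: "(- 1) ^ (i - a) = ((- 1) ^ i * (- 1) ^ a :: 'a)"
    proof -
      have "(- 1) ^ i = ((- 1) ^ (i - a) * (- 1) ^ a :: 'a)" using a by (simp flip: power_add)
      thus ?thesis by (simp add: mult.assoc)
    qed
    have term_eq: "D a (D m x) * D (i - a) ((- t) ^ m) =
        ((- 1) ^ i * ((- 1) ^ a * of_nat (i choose a))) * ?G (a + m)" if "m < ?q - a" for m
    proof -
      have DD: "D a (D m x) = of_nat ((a + m) choose a) * D (a + m) x"
        using below that i a by (auto simp: iter_below_def defect_def)
      have "((a + m) choose a) * (m choose (i - a)) = ((a + m) choose i) * (i choose a)"
      proof (cases "i \<le> a + m")
        case True
        thus ?thesis using choose_mult[of a i "a + m"] a by simp
      next
        case False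
        hence "m < i - a" by simp
        thus ?thesis using False by (simp add: binomial_eq_0)
      qed
      hence C: "(of_nat ((a + m) choose a) * of_nat (m choose (i - a)) :: 'a) =
          of_nat ((a + m) choose i) * of_nat (i choose a)"
        by (metis of_nat_mult)
      have e: "m - (i - a) = a + m - i" using a by simp
      have "D a (D m x) * D (i - a) ((- t) ^ m) =
          (of_nat ((a + m) choose a) * of_nat (m choose (i - a))) * D (a + m) x *
          ((- 1) ^ i * (- 1) ^ a) * (- t) ^ (a + m - i)"
        unfolding DD D_minus_t_power[OF t] e sgn by (simp only: mult_ac)
      thus ?thesis unfolding C by (simp only: mult_ac)
    qed
    \<comment> \<open>Truncation costs nothing: the terms with \<open>a + m\<close> at least
      \<open>?q\<close> vanish by the carry rule.\<close>
    have "(\<Sum>m<?q. D a (D m x) * D (i - a) ((- t) ^ m)) =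
        (\<Sum>m<?q - a. D a (D m x) * D (i - a) ((- t) ^ m))"
      using i a by (intro sum.mono_neutral_right) (auto simp: D_D_carry[OF below])
    also have "\<dots> = ((- 1) ^ i * ((- 1) ^ a * of_nat (i choose a))) * (\<Sum>m<?q - a. ?G (a + m))"
      unfolding sum_distrib_left by (rule sum.cong[OF refl], rule term_eq) simp
    also have "(\<Sum>m<?q - a. ?G (a + m)) = (\<Sum>s\<in>{a..<?q}. ?G s)"
      by (subst sum.atLeastLessThan_shift_0) (simp add: lessThan_atLeast0 o_def)
    \<comment> \<open>The added terms have \<open>s < a\<close>, hence \<open>s < i\<close> and a
      zero binomial, so the sum does not depend on \<open>a\<close>.\<close>
    also have "\<dots> = W"
      unfolding W_def using a by (intro sum.mono_neutral_left) (auto simp: binomial_eq_0)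
    finally show ?thesis .
  qed
  have "D i (taylor t ?q x) = (\<Sum>a\<le>i. \<Sum>m<?q. D a (D m x) * D (i - a) ((- t) ^ m))"
    unfolding taylor_def D_sum D_mult by (rule sum.swap)
  also have "\<dots> = (- 1) ^ i * (\<Sum>a\<le>i. (- 1) ^ a * of_nat (i choose a)) * W"
    by (simp add: inner sum_distrib_left sum_distrib_right)
  also have "\<dots> = 0" using choose_alternating_sum[OF i(1), where 'a='a] by simp
  finally show ?thesis .
qed

text \<open>In the Leibniz rule a term with \<open>a < p ^ l\<close> can be nonzero on the power of
  \<open>- t\<close> only if \<open>a + m\<close> reaches \<open>p ^ l\<close>, and then
  \<open>D a (D m x) = 0\<close> by the carry rule.\<close>

lemma D_taylor_top:
  assumes t: "\<theta> t = fps_const t + fps_X" and below: "iter_below (p ^ l) UNIV"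
  shows "D (p ^ l) (taylor t (p ^ l) x) = (\<Sum>m<p ^ l. D (p ^ l) (D m x) * (- t) ^ m)"
proof -
  let ?q = "p ^ l"
  have "D ?q (D m x * (- t) ^ m) = D ?q (D m x) * (- t) ^ m" if m: "m < ?q" for m
  proof -
    have "D ?q (D m x * (- t) ^ m) = (\<Sum>a\<in>{?q}. D a (D m x) * D (?q - a) ((- t) ^ m))"
      unfolding D_mult
    proof (intro sum.mono_neutral_right ballI)
      fix a assume a: "a \<in> {..?q} - {?q}"
      show "D a (D m x) * D (?q - a) ((- t) ^ m) = 0"
      proof (cases "m < ?q - a")
        case True
        thus ?thesis by (simp add: D_minus_t_power[OF t] binomial_eq_0)
      next
        case False
        thus ?thesis using a m D_D_carry[OF below, of x a m] by simp
      qed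
    qed auto
    thus ?thesis by simp
  qed
  thus ?thesis by (simp add: taylor_def D_sum)
qed

definition level4 :: "'a \<Rightarrow> nat \<Rightarrow> 'a \<Rightarrow> bool" where
  "level4 t l x \<longleftrightarrow>
     (let \<xi> = (\<lambda>n. D n x);
          \<eta> = \<xi> (p ^ l) + (\<Sum>m=1..p ^ l - 1. D (p ^ l) (\<xi> m) * (- t) ^ m)
      in (\<forall>j<l. D (p ^ j) \<eta> = 0) \<and> D (p ^ l * (p - 1)) \<eta> = 0 \<and>
         (\<forall>a. 1 < a \<and> a < p \<longrightarrow>
            \<xi> (a * p ^ l) = inverse (of_nat (fact a)) * (D (p ^ l) ^^ (a - 1)) (\<xi> (p ^ l))) \<and>
         (\<forall>m a. 0 < m \<and> m < p ^ l \<and> 0 < a \<and> a < p \<longrightarrow>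
            \<xi> (m + a * p ^ l) = inverse (of_nat (fact a)) * (D (p ^ l) ^^ a) (\<xi> m)))"

lemma cond4_iff_level4: "cond4 \<theta> p l0 t x k \<longleftrightarrow> (\<forall>l<Suc l0. \<forall>i<k. level4 t l (x i))"
  unfolding cond4_def level4_def less_Suc_eq_le ..

text \<open>Since \<open>\<theta>\<^sup>(\<^sup>q\<^sup>)\<close> maps \<open>taylor t q x\<close> to the element \<open>\<eta>\<close> of condition (4) and the lower
  operators kill it, both conditions can be read off at \<open>taylor t q x\<close>, which differs from
  \<open>x\<close> by an element of \<open>M\<close>.\<close>

lemma level_iff_level4:
  assumes t: "\<theta> t = fps_const t + fps_X" and below: "iter_below (p ^ l) UNIV"
    and M: "is_subfield M" "stable M" "level l M" and tM: "t \<in> M"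
    and xM: "\<And>n. n \<ge> 1 \<Longrightarrow> D n x \<in> M"
  shows "level l {x} \<longleftrightarrow> level4 t l x"
proof -
  let ?q = "p ^ l"
  note MC = subfield_closed[OF M(1)]
  have q0: "?q > 0" using p_pos by simp
  have split: "(\<Sum>m<?q. f m) = f 0 + (\<Sum>m=1..?q - 1. f m)" for f :: "nat \<Rightarrow> 'a"
  proof -
    have "{..<?q} = insert 0 {1..?q - 1}" using q0 by auto
    thus ?thesis by simp
  qed
  define \<zeta> where "\<zeta> = taylor t ?q x"
  define r where "r = (\<Sum>m=1..?q - 1. D m x * (- t) ^ m)"
  define \<eta> where "\<eta> = D ?q x + (\<Sum>m=1..?q - 1. D ?q (D m x) * (- t) ^ m)"
  have \<zeta>: "\<zeta> = x + r" by (simp add: \<zeta>_def taylor_def split r_def)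
  have \<eta>: "D ?q \<zeta> = \<eta>"
    unfolding \<zeta>_def D_taylor_top[OF t below] by (simp add: split \<eta>_def)
  have rM: "r \<in> M"
    unfolding r_def using xM tM by (intro subfield_sum[OF M(1)] MC) auto
  have "D ?q x \<in> M" using xM[of ?q] q0 by linarith
  moreover have "D ?q (D m x) \<in> M" if "m \<ge> 1" for m using stable_D[OF M(2) xM[OF that]] .
  ultimately have \<eta>M: "\<eta> \<in> M"
    unfolding \<eta>_def using tM by (intro subfield_sum[OF M(1)] MC) auto
  have low: "D (p ^ j) \<zeta> = 0" if "j < l" for j
    unfolding \<zeta>_def using that p_gt_1 by (intro D_taylor[OF t below]) auto
  \<comment> \<open>As \<open>D (p ^ j)\<close> kills \<open>x + r\<close> and the operators commute
    at \<open>r\<close>, the commutator at \<open>x\<close> equals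
    \<open>D (p ^ j) \<eta>\<close>.\<close>
  have comm: "D (p ^ j) (D ?q x) = D ?q (D (p ^ j) x) \<longleftrightarrow> D (p ^ j) \<eta> = 0" if j: "j < l" for j
  proof -
    have "D (p ^ j) \<eta> = D (p ^ j) (D ?q x) + D (p ^ j) (D ?q r)"
      by (simp add: \<eta>[symmetric] \<zeta> D_add)
    moreover have "D ?q (D (p ^ j) x) + D ?q (D (p ^ j) r) = 0"
      using low[OF j] by (simp add: \<zeta> flip: D_add)
    moreover have "D (p ^ j) (D ?q r) = D ?q (D (p ^ j) r)"
      using M(3) rM j by (simp add: level_def)
    ultimately show ?thesis by (metis add_right_cancel)
  qed
  \<comment> \<open>On \<open>M\<close> the operator of order \<open>?q * (p - 1)\<close> is the
    power \<open>p - 1\<close> of \<open>D ?q\<close> up to a unit, and \<open>\<eta>\<close> is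
    \<open>D ?q\<close> of \<open>x + r\<close> with \<open>r\<close> killed by the p-th
    power.\<close>
  have pth: "(D ?q ^^ p) x = 0 \<longleftrightarrow> D (?q * (p - 1)) \<eta> = 0"
  proof -
    have "D (0 + (p - 1) * ?q) \<eta> = inverse (of_nat (fact (p - 1))) * (D ?q ^^ (p - 1)) (D 0 \<eta>)"
      using \<eta>M p_gt_1 q0
      by (intro M(3)[unfolded level_def, THEN conjunct1, rule_format]) auto
    hence "D (?q * (p - 1)) \<eta> = inverse (of_nat (fact (p - 1))) * (D ?q ^^ (p - 1)) \<eta>"
      by (simp add: mult.commute del: of_nat_fact)
    moreover have "of_nat (fact (p - 1)) \<noteq> (0::'a)" using p_pos by (intro of_nat_fact_neq_0) simp
    moreover have "(D ?q ^^ (p - 1)) \<eta> = (D ?q ^^ p) \<zeta>"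
      using p_pos unfolding \<eta>[symmetric] by (metis Suc_diff_1 funpow_Suc_right o_apply)
    moreover have "(D ?q ^^ p) r = 0" using M(3) rM by (simp add: level_def)
    hence "(D ?q ^^ p) \<zeta> = (D ?q ^^ p) x" by (simp add: \<zeta> funpow_D_add)
    ultimately show ?thesis by (simp del: of_nat_fact)
  qed
  have shift: "(D ?q ^^ a) x = (D ?q ^^ (a - 1)) (D ?q x)" if "0 < a" for a
    using that by (metis Suc_diff_1 funpow_Suc_right o_apply)
  let ?A = "\<lambda>m a. D (m + a * ?q) x = inverse (of_nat (fact a)) * (D ?q ^^ a) (D m x)"
  let ?B = "\<lambda>a. D (a * ?q) x = inverse (of_nat (fact a)) * (D ?q ^^ (a - 1)) (D ?q x)"
  have A0: "?A 0 a \<longleftrightarrow> ?B a" if "0 < a" for a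
    using shift[OF that] by simp
  \<comment> \<open>For \<open>m = 0\<close> the case \<open>a = 1\<close> is trivial, which is why
    (4) starts at \<open>a > 1\<close> there.\<close>
  have powers: "(\<forall>m a. m < ?q \<and> 0 < a \<and> a < p \<longrightarrow> ?A m a) \<longleftrightarrow>
      (\<forall>a. 1 < a \<and> a < p \<longrightarrow> ?B a) \<and> (\<forall>m a. 0 < m \<and> m < ?q \<and> 0 < a \<and> a < p \<longrightarrow> ?A m a)"
    (is "?L \<longleftrightarrow> ?R")
  proof
    assume ?L
    hence "?A 0 a" if "0 < a" "a < p" for a using q0 that by blast
    hence "?B a" if "1 < a" "a < p" for a using A0[of a] that by simp
    thus ?R using \<open>?L\<close> by blast
  next
    assume R: ?R
    show ?L
    proof (intro allI impI)
      fix m a assume ma: "m < ?q \<and> 0 < a \<and> a < p"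
      consider "m = 0" "a = 1" | "m = 0" "1 < a" | "0 < m" using ma by linarith
      thus "?A m a"
      proof cases
        case 2
        thus ?thesis using R ma A0[of a] by simp
      qed (use R ma in auto)
    qed
  qed
  show ?thesis
    unfolding level_def level4_def Let_def \<eta>_def[symmetric]
    using comm pth powers by (simp del: of_nat_fact) blast
qed

end

theorem theorem5p1:
  fixes \<theta> :: "'a::field \<Rightarrow> 'a fps"
    and C F :: "'a set" and t :: 'a and p :: nat
    and x :: "nat \<Rightarrow> 'a" and k :: nat and l0 :: nat
  assumes char: "CHAR('a) = p" and ppos: "p > 0"
    and C_sub: "is_subfield C" and F_sub: "is_subfield F" and CF: "C \<subseteq> F"
    and tF: "t \<in> F" and t_trans: "transcendental_over C t"
    and F_hd: "higher_derivation F \<theta>" and F_iter: "iterative_on F \<theta>"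
    and theta_C: "\<forall>c\<in>C. \<theta> c = fps_const c"
    and theta_t: "\<theta> t = fps_const t + fps_X"
    and L_fg: "\<exists>S. finite S \<and> gen_field F S = UNIV"
    and L_hd: "higher_derivation UNIV \<theta>"
    and basis: "sep_trans_basis F x k"
    and xi_in: "\<forall>i<k. \<forall>n\<ge>1. hder \<theta> n (x i) \<in> gen_field F {y ^ p | y. True}"
  shows "(cond1 \<theta> p l0 UNIV \<longleftrightarrow> cond2 \<theta> p l0 UNIV) \<and>
         (cond2 \<theta> p l0 UNIV \<longleftrightarrow> cond1 \<theta> p l0 (x ` {..<k})) \<and>
         (cond1 \<theta> p l0 (x ` {..<k}) \<longleftrightarrow> cond2 \<theta> p l0 (x ` {..<k})) \<and>
         (cond2 \<theta> p l0 (x ` {..<k}) \<longleftrightarrow> cond4 \<theta> p l0 t x k)"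
proof -
  have "prime p" using prime_CHAR_semidom[where 'a='a] char ppos by simp
  then interpret higher_deriv_char \<theta> p
    using L_hd char by unfold_locales
  let ?X = "x ` {..<k}"
  define M where "M = gen_field F {y ^ p | y. True}"
  have M_sub: "is_subfield M" by (simp add: M_def is_subfield_gen_field)
  have FM: "F \<subseteq> M" using gen_field_superset[of F] by (auto simp: M_def)
  have pM: "y ^ p \<in> M" for y
    using gen_field_superset[of F "{y ^ p | y. True}"] by (auto simp: M_def)
  have M_stable: "stable M"
    unfolding M_def
  proof (rule stable_gen_field, fold M_def)
    fix y n assume "y \<in> F \<union> {y ^ p | y. True}"
    moreover have "D n y \<in> M" if "y \<in> F"
      using F_hd FM that by (auto simp: higher_derivation_def hder_def)
    ultimately show "D n y \<in> M"
      using pM subfield_closed(1)[OF M_sub] by (auto simp: D_power_p)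
  qed
  \<comment> \<open>By the hypothesis on the coefficients, every operator of positive order sends
    the basis into \<open>M\<close>, so adjoining \<open>M\<close> makes the basis part of a stable
    set.\<close>
  have X_stable: "stable (M \<union> ?X)"
    unfolding stable_def
  proof (intro ballI allI)
    fix y n assume "y \<in> M \<union> ?X"
    thus "D n y \<in> M \<union> ?X"
      using stable_D[OF M_stable] xi_in by (cases "n = 0") (auto simp: M_def)
  qed
  have F_upto: "iter_upto n F" for n
    using F_iter by (auto simp: iter_upto_def defect_def iterative_on_def)
  have sep: "separable_over (gen_field F ?X) y" for y
    using basis by (simp add: sep_trans_basis_def)
  have lift: "iter_upto n UNIV" if "iter_upto n ?X" for n
    using that F_upto[of n]
    by (intro iter_upto_separable[OF iter_upto_gen_field sep]) (auto simp: iter_upto_def)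
  \<comment> \<open>One level is gained here: p-th powers multiply the order by \<open>p\<close>,
    and \<open>F\<close> is iterative to all orders.\<close>
  have to_M: "iter_upto (p ^ Suc l) M" if "iter_upto (p ^ l) UNIV" for l
    unfolding M_def using iter_upto_power_p[OF that] F_upto[of "p ^ Suc l"]
    by (intro iter_upto_gen_field) (auto simp: iter_upto_def)
  \<comment> \<open>This is (3') implies (1), by alternating between the field and \<open>M\<close>:
    orders up to \<open>p ^ l\<close> on the field give level \<open>l\<close> on \<open>M\<close>,
    which joins level \<open>l\<close> on the basis and lifts back.\<close>
  have main: "iter_upto (p ^ l) UNIV" if "\<forall>i<l. level i ?X" for l
    using that
  proof (induction l)
    case 0
    have "defect j m y = 0" if "j + m \<le> 1" for j m y
    proof -
      have "j = 0 \<or> m = 0" using that by linarith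
      thus ?thesis by auto
    qed
    thus ?case by (simp add: iter_upto_def)
  next
    case (Suc l)
    have "iter_upto (p ^ Suc l) M" using Suc by (intro to_M) auto
    hence "\<forall>i<Suc l. level i M" using iter_upto_imp_level by blast
    moreover have "level i (A \<union> B) \<longleftrightarrow> level i A \<and> level i B" for i A B
      by (subst (1 2 3) level_pointwise) (simp only: ball_Un)
    ultimately have "\<forall>i<Suc l. level i (M \<union> ?X)" using Suc.prems by simp
    hence "iter_upto (p ^ Suc l) (M \<union> ?X)" using iter_upto_iff_level[OF X_stable] by blast
    thus ?case by (intro lift) (auto simp: iter_upto_def)
  qed
  \<comment> \<open>The comparison at level \<open>l\<close> presupposes iterativity below
    \<open>p ^ l\<close> on the whole field, which \<open>main\<close> supplies from the lower
    levels; hence the induction.\<close>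
  have four: "(\<forall>i<l. level i ?X) \<longleftrightarrow> (\<forall>j<l. \<forall>i<k. level4 t j (x i))" for l
  proof (induction l)
    case (Suc l)
    have "level l ?X \<longleftrightarrow> (\<forall>i<k. level4 t l (x i))" if "\<forall>i<l. level i ?X"
    proof -
      have up: "iter_upto (p ^ l) UNIV" using main that .
      have "stable UNIV" by (simp add: stable_def)
      hence "iter_below (p ^ l) UNIV" using iter_upto_imp_iter_below up by blast
      moreover have "level l M" using to_M[OF up] by (rule iter_upto_level)
      ultimately have "level l {x i} \<longleftrightarrow> level4 t l (x i)" if "i < k" for i
        using that xi_in tF FM
        by (intro level_iff_level4[OF theta_t _ M_sub M_stable]) (auto simp: M_def)
      moreover have "level l ?X \<longleftrightarrow> (\<forall>i<k. level l {x i})"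
        using level_pointwise[of l ?X] by auto
      ultimately show ?thesis by blast
    qed
    thus ?case using Suc.IH by (auto simp: less_Suc_eq)
  qed simp
  have "stable UNIV" by (simp add: stable_def)
  note c12 = iter_upto_iff_level[OF this, of "Suc l0"]
  have mono: "iter_upto n UNIV \<Longrightarrow> iter_upto n ?X" for n by (simp add: iter_upto_def)
  have "\<forall>i<Suc l0. level i ?X" if "iter_upto (p ^ Suc l0) ?X"
    using iter_upto_imp_level[OF that] by blast
  \<comment> \<open>The cycle is (3) to (3') by the preceding fact, (3') to (1) by
    \<open>main\<close>, and (1) to (3) by restriction; \<open>c12\<close> adds (2) and
    \<open>four\<close> adds (4).\<close>
  thus ?thesis
    unfolding cond1_iff_iter_upto cond2_iff_level cond4_iff_level4
    using c12 lift main four mono by blast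
qed

end
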